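(* Let $N\ge2$ be an integer and let $g_1,\dots,g_N\in W_0$ satisfy the mutual independence condition. (i) If every $g_j$ is odd, then for every choice of points $0<x_1<\dots<x_{N-1}<\tfrac12$ the set $A_N=\left(\{\pm x_1,\dots,\pm x_{N-1}\}\cup\{0,\tfrac12\}\right)+\mathbb{Z}$ is not a uniqueness set for $V^\infty(g_1,\dots,g_N)$. (ii) If every $g_j$ is even, then for every choice of points $0<x_1<\dots<x_{N-1}<\tfrac12$ the set $B_N=\left(\{\pm x_1,\dots,\pm x_{N-1}\}\cup\{\tfrac12\}\right)+\mathbb{Z}$ is not a uniqueness set for $V^\infty(g_1,\dots,g_N)$.
   Context: $W_0$ is the set of continuous functions $g:\mathbb{R}\to\mathbb{C}$ with $\sum_{m\in\mathbb{Z}}\|g\|_{L^\infty(m,m+1)}<\infty$. For $g\in W_0$, $V^\infty(g)=\{\sum_{n\in\mathbb{Z}}c_n g(x-n):\{c_n\}\in\ell^\infty(\mathbb{Z})\}$, and for $g_1,\dots,g_N\in W_0$, $$V^\infty(g_1,\dots,g_N)=\Big\{f(x)=\sum_{j=1}^N\sum_{n\in\mathbb{Z}}c_{j,n}g_j(x-n):\ \{c_{j,n}\}_{n\in\mathbb{Z}}\in\ell^\infty(\mathbb{Z}),\ 1\le j\le N\Big\}.$$ A function $g\in W_0$ satisfies the stability condition if for every $p\in[1,\infty]$ there are constants $A,B>0$ such that $A\|\{c_n\}\|_{\ell^p}\le\|\sum_n c_n g(\cdot-n)\|_{L^p(\mathbb{R})}\le B\|\{c_n\}\|_{\ell^p}$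 for all $\{c_n\}\in\ell^p(\mathbb{Z})$. The functions $g_1,\dots,g_N\in W_0$ satisfy the mutual independence condition if each $g_j$ satisfies the stability condition and every $f\in V^\infty(g_1,\dots,g_N)$ admits a unique decomposition $f=\sum_{j=1}^N f_j$ with $f_j\in V^\infty(g_j)$. A set $\Lambda\subset\mathbb{R}$ is a uniqueness set for a space $V$ of functions on $\mathbb{R}$ if every $f\in V$ vanishing at all points of $\Lambda$ is identically zero. $g$ is odd if $g(-x)=-g(x)$ and even if $g(-x)=g(x)$ for all $x\in\mathbb{R}$. *)

theory Defs
  imports "HOL-Probability.Probability"
begin

(* L^p norm for 1 <= p <= \<infinity>; it is \<infinity> when f is not in L^p. An infinite integral is
   treated separately because enn2real \<infinity> = 0, and ennreal has no powr. *)
definition Lp_norm :: "ennreal \<Rightarrow> 'a measure \<Rightarrow> ('a \<Rightarrow> complex) \<Rightarrow> ennreal" where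
  "Lp_norm p M f =
     (if p = \<infinity> then esssup M (\<lambda>x. ennreal (norm (f x)))
      else (let I = (\<integral>\<^sup>+ x. ennreal (norm (f x) powr enn2real p) \<partial>M)
            in if I = \<infinity> then \<infinity> else ennreal (enn2real I powr (1 / enn2real p))))"

abbreviation lp_norm :: "ennreal \<Rightarrow> (int \<Rightarrow> complex) \<Rightarrow> ennreal" where
  "lp_norm p c \<equiv> Lp_norm p (count_space UNIV) c"

definition lp_space :: "ennreal \<Rightarrow> (int \<Rightarrow> complex) set" where
  "lp_space p = {c. lp_norm p c < \<infinity>}"

definition W0 :: "(real \<Rightarrow> complex) set" where
  "W0 = {g. continuous_on UNIV g \<and>
        (\<Sum>\<^sub>\<infinity>m\<in>(UNIV :: int set).
           Lp_norm \<infinity> (restrict_space lborel {real_of_int m <..< real_of_int m + 1}) g) < \<infinity>}"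

(* For g in W0 and bounded c the series converges absolutely at every point. *)
definition shift_series :: "(real \<Rightarrow> complex) \<Rightarrow> (int \<Rightarrow> complex) \<Rightarrow> real \<Rightarrow> complex" where
  "shift_series g c x = (\<Sum>\<^sub>\<infinity>n\<in>UNIV. c n * g (x - real_of_int n))"

definition V_inf :: "(real \<Rightarrow> complex) \<Rightarrow> (real \<Rightarrow> complex) set" where
  "V_inf g = {shift_series g c | c. c \<in> lp_space \<infinity>}"

definition V_inf_multi :: "nat \<Rightarrow> (nat \<Rightarrow> real \<Rightarrow> complex) \<Rightarrow> (real \<Rightarrow> complex) set" where
  "V_inf_multi N g =
     {\<lambda>x. \<Sum>j=1..N. shift_series (g j) (c j) x | c. \<forall>j\<in>{1..N}. c j \<in> lp_space \<infinity>}"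

definition stability_condition :: "(real \<Rightarrow> complex) \<Rightarrow> bool" where
  "stability_condition g \<longleftrightarrow>
     (\<forall>p\<ge>1. \<exists>A>0. \<exists>B>0. \<forall>c\<in>lp_space p.
        ennreal A * lp_norm p c \<le> Lp_norm p lborel (shift_series g c) \<and>
        Lp_norm p lborel (shift_series g c) \<le> ennreal B * lp_norm p c)"

(* Decompositions are taken in the extensional product PiE, so that uniqueness
   concerns only the components with index in {1..N}. *)
definition mutual_independence :: "nat \<Rightarrow> (nat \<Rightarrow> real \<Rightarrow> complex) \<Rightarrow> bool" where
  "mutual_independence N g \<longleftrightarrow>
     (\<forall>j\<in>{1..N}. stability_condition (g j)) \<and>
     (\<forall>f\<in>V_inf_multi N g.
        \<exists>!F. F \<in> (\<Pi>\<^sub>E j\<in>{1..N}. V_inf (g j)) \<and> f = (\<lambda>x. \<Sum>j=1..N. F j x))"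

definition uniqueness_set :: "real set \<Rightarrow> (real \<Rightarrow> complex) set \<Rightarrow> bool" where
  "uniqueness_set \<Lambda> V \<longleftrightarrow>
     (\<forall>f\<in>V. (\<forall>x\<in>\<Lambda>. f x = 0) \<longrightarrow> (\<forall>x. f x = 0))"

definition odd_fun :: "(real \<Rightarrow> complex) \<Rightarrow> bool" where
  "odd_fun g \<longleftrightarrow> (\<forall>x. g (- x) = - g x)"

definition even_fun :: "(real \<Rightarrow> complex) \<Rightarrow> bool" where
  "even_fun g \<longleftrightarrow> (\<forall>x. g (- x) = g x)"

definition plus_integers :: "real set \<Rightarrow> real set" where
  "plus_integers S = {s + real_of_int k | s k. s \<in> S}"

definition A_set :: "nat \<Rightarrow> (nat \<Rightarrow> real) \<Rightarrow> real set" where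
  "A_set N x = plus_integers (x ` {1..N-1} \<union> (\<lambda>i. - x i) ` {1..N-1} \<union> {0, 1/2})"

definition B_set :: "nat \<Rightarrow> (nat \<Rightarrow> real) \<Rightarrow> real set" where
  "B_set N x = plus_integers (x ` {1..N-1} \<union> (\<lambda>i. - x i) ` {1..N-1} \<union> {1/2})"

end

theory Submission
  imports Defs
begin

text \<open>
  The function vanishing on the given set is a combination of the generators whose coefficient
  sequences are geometric: \<open>f = (\<Sum>j. a j * G j)\<close> with \<open>G j x = (\<Sum>n. s^n * g j (x - n))\<close>, where
  \<open>s = 1\<close> in the odd case and \<open>s = -1\<close> in the even case. Then \<open>G j (x + 1) = s * G j x\<close>, and the
  parity of \<open>g j\<close>, which in both cases reads \<open>g j (-x) = -s * g j x\<close>, is inherited by \<open>G j\<close>. Since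
  \<open>1/2\<close> and \<open>-1/2\<close> differ by \<open>1\<close> and are exchanged by reflection, the two symmetries give
  \<open>G j (1/2) = -s\<^sup>2 * G j (1/2)\<close>, so \<open>f\<close> vanishes at \<open>1/2\<close> at no cost. For \<open>s = 1\<close> it vanishes at \<open>0\<close>
  as well, because \<open>f\<close> is odd.

  What remains is \<open>f (x i) = 0\<close> for \<open>i = 1, ..., N - 1\<close>; the symmetries carry these zeros
  to \<open>-x i\<close> and to all integer translates. These are \<open>N - 1\<close> homogeneous equations in the \<open>N\<close>
  unknowns \<open>a j\<close>, so a solution \<open>a \<noteq> 0\<close> exists. The corresponding \<open>f\<close> is not the zero
  function: otherwise uniqueness of the decomposition of \<open>0\<close> would give \<open>a j * G j = 0\<close> for
  every \<open>j\<close>, and the lower stability bound for the exponent \<open>\<infinity>\<close> would give \<open>a j = 0\<close>.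
\<close>

section \<open>Underdetermined homogeneous systems\<close>

text \<open>Gaussian elimination: one equation serves to eliminate one unknown \<open>j0\<close>, and the induction
  hypothesis applies to the remaining equations in the remaining unknowns.\<close>

lemma underdetermined_homogeneous_system:
  fixes M :: "'i \<Rightarrow> 'j \<Rightarrow> 'a :: field"
  assumes "finite I" "finite J" "card I < card J"
  shows "\<exists>a. (\<exists>j\<in>J. a j \<noteq> 0) \<and> (\<forall>i\<in>I. (\<Sum>j\<in>J. a j * M i j) = 0)"
  using assms
proof (induction I arbitrary: J M rule: finite_induct)
  case empty
  then have "J \<noteq> {}" by auto
  then show ?case by (intro exI[of _ "\<lambda>_. 1"]) auto
next
  case (insert i0 I)
  show ?case
  proof (cases "\<forall>j\<in>J. M i0 j = 0")
    case True
    obtain a where "\<exists>j\<in>J. a j \<noteq> 0" "\<forall>i\<in>I. (\<Sum>j\<in>J. a j * M i j) = 0"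
      using insert.IH[of J M] insert.prems insert.hyps by auto
    then show ?thesis using True by (intro exI[of _ a]) auto
  next
    case False
    then obtain j0 where j0: "j0 \<in> J" "M i0 j0 \<noteq> 0" by auto
    define J' where "J' = J - {j0}"
    define q where "q j = M i0 j / M i0 j0" for j
    have J': "finite J'" "card I < card J'" "j0 \<notin> J'" and J: "J = insert j0 J'"
      using insert.prems insert.hyps j0 by (auto simp: J'_def)
    obtain b where b: "\<exists>j\<in>J'. b j \<noteq> 0" "\<forall>i\<in>I. (\<Sum>j\<in>J'. b j * (M i j - M i j0 * q j)) = 0"
      using insert.IH[OF J'(1,2), of "\<lambda>i j. M i j - M i j0 * q j"] by auto
    define a where "a = b(j0 := - (\<Sum>j\<in>J'. b j * q j))"
    have sum_a: "(\<Sum>j\<in>J. a j * M i j) = (\<Sum>j\<in>J'. b j * (M i j - M i j0 * q j))" for i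
    proof -
      have "(\<Sum>j\<in>J'. a j * M i j) = (\<Sum>j\<in>J'. b j * M i j)"
        using J' by (intro sum.cong) (auto simp: a_def)
      then have "(\<Sum>j\<in>J. a j * M i j) = (\<Sum>j\<in>J'. b j * M i j) - (\<Sum>j\<in>J'. b j * q j) * M i j0"
        using J' by (simp add: J a_def)
      then show ?thesis
        by (simp add: right_diff_distrib sum_subtractf sum_distrib_right sum_distrib_left mult_ac)
    qed
    have "\<exists>j\<in>J. a j \<noteq> 0" using b(1) J' by (auto simp: J a_def)
    moreover have "\<forall>i\<in>insert i0 I. (\<Sum>j\<in>J. a j * M i j) = 0"
      using b(2) j0 by (auto simp: sum_a q_def)
    ultimately show ?thesis by blast
  qed
qed

section \<open>Bounded coefficients and the sup norm\<close>

lemma bounded_in_lp_space_infinity: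
  assumes "\<And>n. norm (c n) \<le> B"
  shows "c \<in> lp_space \<infinity>"
proof -
  have "lp_norm \<infinity> c \<le> ennreal B"
    unfolding Lp_norm_def using assms by (auto intro!: esssup_I AE_I2 ennreal_leI)
  then show ?thesis
    by (auto simp: lp_space_def intro: le_less_trans)
qed

text \<open>The lower bound for the exponent \<open>\<infinity>\<close> compares the coefficients with the supremum of the
  series, so the synthesis map is injective on bounded sequences.\<close>

lemma stability_imp_shift_series_injective:
  assumes "stability_condition g" "c \<in> lp_space \<infinity>" "\<And>x. shift_series g c x = 0"
  shows "c n = 0"
proof -
  have "(1::ennreal) \<le> \<infinity>" by simp
  with assms(1) obtain A where "A > 0"
    and "\<forall>c\<in>lp_space \<infinity>. ennreal A * lp_norm \<infinity> c \<le> Lp_norm \<infinity> lborel (shift_series g c)"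
    unfolding stability_condition_def by blast
  with assms(2) have "ennreal A * lp_norm \<infinity> c \<le> Lp_norm \<infinity> lborel (shift_series g c)"
    by blast
  moreover have "Lp_norm \<infinity> lborel (shift_series g c) \<le> 0"
    unfolding Lp_norm_def if_P[OF refl] by (rule esssup_I) (simp_all add: assms(3))
  ultimately have "ennreal A * lp_norm \<infinity> c = 0" by simp
  with \<open>A > 0\<close> have "lp_norm \<infinity> c = 0" by auto
  moreover have "AE n in count_space UNIV. ennreal (norm (c n)) \<le> lp_norm \<infinity> c"
    unfolding Lp_norm_def by (simp only: if_True refl) (rule esssup_AE)
  ultimately show ?thesis
    by (simp add: AE_count_space)
qed

text \<open>The decomposition of the zero function is trivial, so a vanishing sum of series vanishes
  term by term; the lower stability bound then removes the individual coefficients.\<close>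

lemma mutual_independence_imp_coefficients_zero:
  assumes "mutual_independence N g" "\<And>j. j \<in> {1..N} \<Longrightarrow> c j \<in> lp_space \<infinity>"
    and zero: "\<And>x. (\<Sum>j=1..N. shift_series (g j) (c j) x) = 0"
    and j: "j \<in> {1..N}"
  shows "c j n = 0"
proof -
  let ?P = "\<lambda>F. F \<in> (\<Pi>\<^sub>E j\<in>{1..N}. V_inf (g j)) \<and> (\<lambda>x. 0) = (\<lambda>x. \<Sum>j=1..N. F j x)"
  define F where "F = (\<lambda>j\<in>{1..N}. shift_series (g j) (c j))"
  define Z where "Z = (\<lambda>j\<in>{1..N}. \<lambda>x::real. 0::complex)"
  have "(\<lambda>x. 0) \<in> V_inf_multi N g"
    unfolding V_inf_multi_def using assms(2) zero by (force intro!: exI[of _ c])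
  with assms(1) have "\<exists>!F. ?P F"
    unfolding mutual_independence_def by blast
  moreover have "?P F"
    using assms(2) zero by (auto simp: F_def V_inf_def)
  moreover have "?P Z"
  proof -
    have "(\<lambda>_. 0) \<in> lp_space \<infinity>"
      by (rule bounded_in_lp_space_infinity[of _ 0]) simp
    moreover have "shift_series h (\<lambda>_. 0) = (\<lambda>_. 0)" for h
      by (simp add: shift_series_def fun_eq_iff)
    ultimately have "(\<lambda>_. 0) \<in> V_inf h" for h
      unfolding V_inf_def mem_Collect_eq by (intro exI[of _ "\<lambda>_. 0"]) simp
    then show ?thesis by (auto simp: Z_def)
  qed
  ultimately have "F = Z" by blast
  then have "F j = Z j" by simp
  then have "shift_series (g j) (c j) x = 0" for x
    using j by (simp add: F_def Z_def)
  with assms(1,2) j show ?thesis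
    by (intro stability_imp_shift_series_injective[of "g j" "c j"])
      (auto simp: mutual_independence_def)
qed

section \<open>Series with geometric coefficients\<close>

text \<open>The substitution \<open>n \<mapsto> n + k\<close> multiplies a geometric sequence by \<open>s^k\<close>.\<close>

lemma shift_series_geometric_translate:
  assumes "s \<noteq> 0"
  shows "shift_series g (\<lambda>n. a * s powi n) (x + of_int k) =
    s powi k * shift_series g (\<lambda>n. a * s powi n) x"
proof -
  have "bij (\<lambda>n::int. n + k)" by (rule bij_plus_right)
  then have "shift_series g (\<lambda>n. a * s powi n) (x + of_int k) =
      (\<Sum>\<^sub>\<infinity>n\<in>UNIV. a * s powi (n + k) * g (x + of_int k - of_int (n + k)))"
    unfolding shift_series_def by (rule infsum_reindex_bij_betw[symmetric])
  also have "\<dots> = (\<Sum>\<^sub>\<infinity>n\<in>UNIV. s powi k * (a * s powi n * g (x - of_int n)))"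
    using assms by (intro infsum_cong) (simp add: power_int_add mult_ac)
  finally show ?thesis
    by (simp add: shift_series_def infsum_cmult_right')
qed

text \<open>For \<open>s = 1\<close> or \<open>s = -1\<close> the coefficient sequence is even, so parity of \<open>g\<close> passes to the
  series.\<close>

lemma shift_series_geometric_reflect:
  assumes s: "s * s = 1" and g: "\<And>x. g (- x) = t * g x"
  shows "shift_series g (\<lambda>n. a * s powi n) (- x) = t * shift_series g (\<lambda>n. a * s powi n) x"
proof -
  have inv: "inverse s = s" using s by (metis inverse_unique)
  have "bij (uminus :: int \<Rightarrow> int)" by (rule bij_uminus)
  then have "shift_series g (\<lambda>n. a * s powi n) (- x) =
      (\<Sum>\<^sub>\<infinity>n\<in>UNIV. a * s powi (- n) * g (- x - of_int (- n)))"
    unfolding shift_series_def by (rule infsum_reindex_bij_betw[symmetric])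
  also have "\<dots> = (\<Sum>\<^sub>\<infinity>n\<in>UNIV. t * (a * s powi n * g (x - of_int n)))"
  proof (rule infsum_cong)
    fix n :: int
    have "s powi (- n) = s powi n"
      by (metis inv power_int_inverse power_int_minus)
    moreover have "g (- x - of_int (- n)) = t * g (x - of_int n)"
      using g[of "x - of_int n"] by simp
    ultimately show "a * s powi (- n) * g (- x - of_int (- n)) =
        t * (a * s powi n * g (x - of_int n))" by simp
  qed
  finally show ?thesis
    by (simp add: shift_series_def infsum_cmult_right')
qed

lemma zero_on_plus_integers:
  fixes f :: "real \<Rightarrow> complex"
  assumes "y \<in> plus_integers S"
    and "\<And>y k. f (y + of_int k) = s powi k * f y" "\<And>t. t \<in> S \<Longrightarrow> f t = 0"
  shows "f y = 0"
proof -
  from assms(1) obtain t k where "t \<in> S" "y = t + of_int k"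
    unfolding plus_integers_def by blast
  then show ?thesis by (simp only: assms(2,3) mult_zero_right)
qed

section \<open>A nonzero function with prescribed zeros\<close>

text \<open>The assumption on \<open>g\<close> is the parity that pairs with the multiplier \<open>s\<close>: odd generators
  for \<open>s = 1\<close>, even ones for \<open>s = -1\<close>. It is exactly what makes \<open>1/2\<close> a free zero.\<close>

lemma exists_nonzero_quasiperiodic_with_zeros:
  fixes s :: complex and x :: "nat \<Rightarrow> real"
  assumes "mutual_independence N g" "N \<ge> 1"
    and s: "s = 1 \<or> s = -1"
    and parity: "\<And>j y. j \<in> {1..N} \<Longrightarrow> g j (- y) = - s * g j y"
  obtains f where "f \<in> V_inf_multi N g" "\<exists>y. f y \<noteq> 0"
    "\<And>y k. f (y + of_int k) = s powi k * f y" "\<And>y. f (- y) = - s * f y"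
    "f (1/2) = 0" "\<And>i. i \<in> {1..N-1} \<Longrightarrow> f (x i) = 0"
proof -
  define G where "G j = shift_series (g j) (\<lambda>n. 1 * s powi n)" for j
  have "card {1..N-1} < card {1..N}" using assms(2) by simp
  then obtain a where a: "\<exists>j\<in>{1..N}. a j \<noteq> 0"
    "\<forall>i\<in>{1..N-1}. (\<Sum>j\<in>{1..N}. a j * G j (x i)) = 0"
    using underdetermined_homogeneous_system[of "{1..N-1}" "{1..N}" "\<lambda>i j. G j (x i)"] by blast
  define c where "c j = (\<lambda>n::int. a j * s powi n)" for j
  define f where "f y = (\<Sum>j=1..N. shift_series (g j) (c j) y)" for y
  have c_bounded: "c j \<in> lp_space \<infinity>" for j
    using s by (intro bounded_in_lp_space_infinity[of _ "norm (a j)"])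
      (auto simp: c_def norm_mult norm_power_int)
  have f_eq: "f y = (\<Sum>j=1..N. a j * G j y)" for y
    by (simp add: f_def c_def G_def shift_series_def mult.assoc infsum_cmult_right')
  have translate: "f (y + of_int k) = s powi k * f y" for y k
    using s unfolding f_def c_def sum_distrib_left
    by (intro sum.cong refl shift_series_geometric_translate) auto
  have reflect: "f (- y) = - s * f y" for y
    using s parity unfolding f_def c_def sum_distrib_left
    by (intro sum.cong refl shift_series_geometric_reflect) auto
  have "f (1/2) = 0"
  proof -
    have "f (1/2) = s * f (- (1/2))" using translate[of "- (1/2)" 1] by simp
    also have "\<dots> = - f (1/2)" unfolding reflect using s by auto
    finally show ?thesis by simp
  qed
  moreover have "f \<in> V_inf_multi N g"
    unfolding V_inf_multi_def f_def[abs_def] using c_bounded by blast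
  moreover have "\<exists>y. f y \<noteq> 0"
  proof (rule ccontr)
    assume "\<not> (\<exists>y. f y \<noteq> 0)"
    then have "(\<Sum>j=1..N. shift_series (g j) (c j) y) = 0" for y by (simp add: f_def)
    then have "c j 0 = 0" if "j \<in> {1..N}" for j
      using mutual_independence_imp_coefficients_zero[where c = c, OF assms(1)] c_bounded that by blast
    with a(1) show False by (auto simp: c_def)
  qed
  moreover have "f (x i) = 0" if "i \<in> {1..N-1}" for i
    using a(2) that by (simp add: f_eq)
  ultimately show ?thesis by (intro that[of f] translate reflect)
qed

theorem theorem3p5:
  fixes N :: nat and g :: "nat \<Rightarrow> real \<Rightarrow> complex"
  assumes "N \<ge> 2"
    and "\<forall>j\<in>{1..N}. g j \<in> W0"
    and "mutual_independence N g"
  shows "((\<forall>j\<in>{1..N}. odd_fun (g j)) \<longrightarrow>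
           (\<forall>x :: nat \<Rightarrow> real.
              strict_mono_on {1..N-1} x \<and> (\<forall>i\<in>{1..N-1}. 0 < x i \<and> x i < 1/2) \<longrightarrow>
              \<not> uniqueness_set (A_set N x) (V_inf_multi N g))) \<and>
         ((\<forall>j\<in>{1..N}. even_fun (g j)) \<longrightarrow>
           (\<forall>x :: nat \<Rightarrow> real.
              strict_mono_on {1..N-1} x \<and> (\<forall>i\<in>{1..N-1}. 0 < x i \<and> x i < 1/2) \<longrightarrow>
              \<not> uniqueness_set (B_set N x) (V_inf_multi N g)))"
proof (intro conjI impI allI)
  have N: "N \<ge> 1" using assms(1) by simp
  fix x :: "nat \<Rightarrow> real"
  {
    assume odd: "\<forall>j\<in>{1..N}. odd_fun (g j)"
    obtain f where f: "f \<in> V_inf_multi N g" "\<exists>y. f y \<noteq> 0"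
      "\<And>y k. f (y + of_int k) = 1 powi k * f y" "\<And>y. f (- y) = - 1 * f y"
      "f (1/2) = 0" "\<And>i. i \<in> {1..N-1} \<Longrightarrow> f (x i) = 0"
      using exists_nonzero_quasiperiodic_with_zeros[OF assms(3) N, of 1 x] odd
      by (auto simp: odd_fun_def)
    have "f 0 = 0" using f(4)[of 0] by simp
    have "\<forall>y\<in>A_set N x. f y = 0"
      unfolding A_set_def using \<open>f 0 = 0\<close> f(4-6) by (auto elim!: zero_on_plus_integers[OF _ f(3)])
    with f(1,2) show "\<not> uniqueness_set (A_set N x) (V_inf_multi N g)"
      unfolding uniqueness_set_def by blast
  next
    assume even: "\<forall>j\<in>{1..N}. even_fun (g j)"
    obtain f where f: "f \<in> V_inf_multi N g" "\<exists>y. f y \<noteq> 0"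
      "\<And>y k. f (y + of_int k) = (-1) powi k * f y" "\<And>y. f (- y) = - (-1) * f y"
      "f (1/2) = 0" "\<And>i. i \<in> {1..N-1} \<Longrightarrow> f (x i) = 0"
      using exists_nonzero_quasiperiodic_with_zeros[OF assms(3) N, of "-1" x] even
      by (auto simp: even_fun_def)
    have "\<forall>y\<in>B_set N x. f y = 0"
      unfolding B_set_def using f(4-6) by (auto elim!: zero_on_plus_integers[OF _ f(3)])
    with f(1,2) show "\<not> uniqueness_set (B_set N x) (V_inf_multi N g)"
      unfolding uniqueness_set_def by blast
  }
qed

end
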